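(* Let $n\ge2$ and let $\mathfrak g$ be of type $A_{n-1}$. The number of two-strand atoms is $\binom{n+1}{3}=n(n^2-1)/6$. The number of those two-strand atoms whose domain labels are weakly increasing (i.e. with domain $B_i\otimes B_j$, $i\le j$) is $$\left\lfloor\frac{n(2n^2+3n-2)}{24}\right\rfloor.$$
   Context: Let $\mathfrak g=\mathfrak{sl}_n$ with simple coroots $\alpha_i^\vee$ and fundamental weights $\omega_i$, $1\le i\le n-1$, and let $B_i=B(\omega_i)$ be the crystal of the $i$th fundamental representation, with Kashiwara operators $e_i,f_i:B\to B\sqcup\{0\}$; $\varepsilon_i(b)=\max\{m:e_i^mb\ne0\}$, $\varphi_i(b)=\max\{m:f_i^mb\ne0\}$. Tensor products of crystals use the convention $e_i(b\otimes c)=e_ib\otimes c$ if $\varphi_i(b)\ge\varepsilon_i(c)$ and $b\otimes e_ic$ otherwise, $f_i(b\otimes c)=f_ib\otimes c$ if $\varphi_i(b)>\varepsilon_i(c)$ and $b\otimes f_ic$ otherwise. For a tensor word $B_{\epsilon_1}\otimes\cdots\otimes B_{\epsilon_m}$ its top component is the unique connected component of highest weight $\sum_k\omega_{\epsilon_k}$, and its highest element is the highest weight element of that component. For each $b\in B_k$ let $B_{\epsilon(b)}=B_1^{\otimes\varepsilon_1(b)}\otimes\cdots\otimes B_{n-1}^{\otimes\varepsilon_{n-1}(b)}$ and $B_{\delta(b)}=B_1^{\otimes\varphi_1(b)}\otimes\cdots\otimes B_{n-1}^{\otimes\varphi_{n-1}(b)}$, and let $c$ be the highest element of $B_{\epsilon(b)}$.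 The atom $f_b:B_{\epsilon(b)}\otimes B_k\to B_{\delta(b)}$ is the crystal morphism mapping the connected component generated by the highest weight element $c\otimes b$ onto the top component of $B_{\delta(b)}$ and zero on all other components. There is one atom for each element of $\bigsqcup_kB_k$. A two-strand atom is an atom whose domain is of the form $B_i\otimes B_j$. *)

theory Defs
  imports Complex_Main
begin

text \<open>
  Crystals of type \<open>A\<close> with index set \<open>{1..<n}\<close>. The value \<open>None\<close> plays the role of the extra
  element \<open>0\<close>. A weight is given by its pairings with the simple coroots, i.e. by its coordinates
  in the basis of fundamental weights.
\<close>

record 'a crystal =
  elts :: "'a set"
  eop :: "nat \<Rightarrow> 'a \<Rightarrow> 'a option"
  fop :: "nat \<Rightarrow> 'a \<Rightarrow> 'a option"
  wt :: "'a \<Rightarrow> nat \<Rightarrow> int"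

definition opow :: "('a \<Rightarrow> 'a option) \<Rightarrow> nat \<Rightarrow> 'a \<Rightarrow> 'a option" where
  "opow g m b = ((\<lambda>x. Option.bind x g) ^^ m) (Some b)"

definition epsilon :: "'a crystal \<Rightarrow> nat \<Rightarrow> 'a \<Rightarrow> nat" where
  "epsilon C i b = Max {m. opow (eop C i) m b \<noteq> None}"

definition phi :: "'a crystal \<Rightarrow> nat \<Rightarrow> 'a \<Rightarrow> nat" where
  "phi C i b = Max {m. opow (fop C i) m b \<noteq> None}"

definition fund_weight :: "nat \<Rightarrow> nat \<Rightarrow> int" where
  "fund_weight k = (\<lambda>j. if j = k then 1 else 0)"

text \<open>
  The crystal of the \<open>k\<close>-th fundamental representation (the \<open>k\<close>-th exterior power of the vector
  representation) of \<open>sl\<^sub>n\<close>, in its standard model by one-column tableaux: the \<open>k\<close>-element subsets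
  of \<open>{1..n}\<close>, where \<open>f\<^sub>i\<close> replaces the entry \<open>i\<close> by \<open>i + 1\<close>. The highest weight element is \<open>{1..k}\<close>.
\<close>

definition fund_crystal :: "nat \<Rightarrow> nat \<Rightarrow> nat set crystal" where
  "fund_crystal n k =
    \<lparr> elts = {S. S \<subseteq> {1..n} \<and> card S = k},
      eop = (\<lambda>i S. if i \<in> {1..<n} \<and> i + 1 \<in> S \<and> i \<notin> S then Some (insert i (S - {i + 1})) else None),
      fop = (\<lambda>i S. if i \<in> {1..<n} \<and> i \<in> S \<and> i + 1 \<notin> S then Some (insert (i + 1) (S - {i})) else None),
      wt = (\<lambda>S i. if i \<in> {1..<n} then of_bool (i \<in> S) - of_bool (i + 1 \<in> S) else 0) \<rparr>"

text \<open>
  An iterated tensor product \<open>b\<^sub>1 \<otimes> (b\<^sub>2 \<otimes> \<dots>)\<close> is represented by the list \<open>[b\<^sub>1, b\<^sub>2, \<dots>]\<close>;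
  the tensor product of crystals is associative, so the bracketing is immaterial.
\<close>

definition tensor_cons :: "'a crystal \<Rightarrow> 'a list crystal \<Rightarrow> 'a list crystal" where
  "tensor_cons A B =
    \<lparr> elts = {b # c | b c. b \<in> elts A \<and> c \<in> elts B},
      eop = (\<lambda>i z. case z of [] \<Rightarrow> None
        | b # c \<Rightarrow> if phi A i b \<ge> epsilon B i c
                   then map_option (\<lambda>b'. b' # c) (eop A i b)
                   else map_option (\<lambda>c'. b # c') (eop B i c)),
      fop = (\<lambda>i z. case z of [] \<Rightarrow> None
        | b # c \<Rightarrow> if phi A i b > epsilon B i c
                   then map_option (\<lambda>b'. b' # c) (fop A i b)
                   else map_option (\<lambda>c'. b # c') (fop B i c)),
      wt = (\<lambda>z j. case z of [] \<Rightarrow> 0 | b # c \<Rightarrow> wt A b j + wt B c j) \<rparr>"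

text \<open>
  The tensor word of fundamental crystals with the given labels; the empty word is the
  trivial crystal \<open>B(0)\<close>.
\<close>

primrec word_crystal :: "nat \<Rightarrow> nat list \<Rightarrow> nat set list crystal" where
  "word_crystal n [] =
    \<lparr> elts = {[]}, eop = (\<lambda>i z. None), fop = (\<lambda>i z. None), wt = (\<lambda>z j. 0) \<rparr>"
| "word_crystal n (k # w) = tensor_cons (fund_crystal n k) (word_crystal n w)"

definition component :: "nat \<Rightarrow> 'a crystal \<Rightarrow> 'a \<Rightarrow> 'a set" where
  "component n C x =
    {y. (x, y) \<in> {(u, v). \<exists>i\<in>{1..<n}. eop C i u = Some v \<or> fop C i u = Some v}\<^sup>*}"

definition highest_weight_element :: "nat \<Rightarrow> 'a crystal \<Rightarrow> 'a \<Rightarrow> bool" where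
  "highest_weight_element n C x \<longleftrightarrow> x \<in> elts C \<and> (\<forall>i\<in>{1..<n}. eop C i x = None)"

definition highest_element :: "nat \<Rightarrow> nat list \<Rightarrow> nat set list" where
  "highest_element n w =
    (THE h. highest_weight_element n (word_crystal n w) h \<and>
            wt (word_crystal n w) h = (\<lambda>j. \<Sum>k\<leftarrow>w. fund_weight k j))"

definition top_component :: "nat \<Rightarrow> nat list \<Rightarrow> nat set list set" where
  "top_component n w = component n (word_crystal n w) (highest_element n w)"

text \<open>
  A strict morphism of crystals \<open>C \<rightarrow> D \<squnion> {0}\<close>. It is required to be \<open>None\<close> outside \<open>C\<close>
  so that equality of functions is equality of morphisms.
\<close>

definition crystal_morphism ::
  "nat \<Rightarrow> 'a crystal \<Rightarrow> 'b crystal \<Rightarrow> ('a \<Rightarrow> 'b option) \<Rightarrow> bool" where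
  "crystal_morphism n C D \<psi> \<longleftrightarrow>
    (\<forall>x. x \<notin> elts C \<longrightarrow> \<psi> x = None) \<and>
    (\<forall>x\<in>elts C. \<forall>y. \<psi> x = Some y \<longrightarrow>
       y \<in> elts D \<and> wt D y = wt C x \<and>
       (\<forall>i\<in>{1..<n}. epsilon D i y = epsilon C i x \<and> phi D i y = phi C i x)) \<and>
    (\<forall>x\<in>elts C. \<forall>i\<in>{1..<n}.
       Option.bind (eop C i x) \<psi> = Option.bind (\<psi> x) (eop D i) \<and>
       Option.bind (fop C i x) \<psi> = Option.bind (\<psi> x) (fop D i))"

definition epsilon_word :: "nat \<Rightarrow> nat \<Rightarrow> nat set \<Rightarrow> nat list" where
  "epsilon_word n k b = concat (map (\<lambda>i. replicate (epsilon (fund_crystal n k) i b) i) [1..<n])"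

definition delta_word :: "nat \<Rightarrow> nat \<Rightarrow> nat set \<Rightarrow> nat list" where
  "delta_word n k b = concat (map (\<lambda>i. replicate (phi (fund_crystal n k) i b) i) [1..<n])"

definition is_atom_map ::
  "nat \<Rightarrow> nat \<Rightarrow> nat set \<Rightarrow> (nat set list \<Rightarrow> nat set list option) \<Rightarrow> bool" where
  "is_atom_map n k b \<psi> \<longleftrightarrow>
    (let dom = word_crystal n (epsilon_word n k b @ [k]);
         cod = word_crystal n (delta_word n k b);
         K = component n dom (highest_element n (epsilon_word n k b) @ [b])
     in crystal_morphism n dom cod \<psi> \<and>
        \<psi> ` K = Some ` top_component n (delta_word n k b) \<and>
        (\<forall>x \<in> elts dom - K. \<psi> x = None))"

text \<open>An atom, as a morphism, carries the label words of its domain and of its codomain.\<close>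

type_synonym atom = "nat list \<times> nat list \<times> (nat set list \<Rightarrow> nat set list option)"

definition atoms :: "nat \<Rightarrow> atom set" where
  "atoms n = {(epsilon_word n k b @ [k], delta_word n k b, \<psi>) | k b \<psi>.
     k \<in> {1..<n} \<and> b \<in> elts (fund_crystal n k) \<and> is_atom_map n k b \<psi>}"

definition two_strand_atoms :: "nat \<Rightarrow> atom set" where
  "two_strand_atoms n = {a \<in> atoms n. \<exists>i j. fst a = [i, j]}"

definition increasing_two_strand_atoms :: "nat \<Rightarrow> atom set" where
  "increasing_two_strand_atoms n = {a \<in> atoms n. \<exists>i j. fst a = [i, j] \<and> i \<le> j}"

end

theory Submission
  imports Defs
begin

text \<open>
  An atom \<open>f\<^sub>b\<close> has two strands iff exactly one \<open>e\<^sub>p\<close> acts nontrivially on the column \<open>b\<close>, that is, iff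
  \<open>b = {1..a} \<union> {p+1..r}\<close> with \<open>0 \<le> a < p < r \<le> n\<close>. Its domain is then \<open>B\<^sub>p \<otimes> B\<^sub>k\<close> with
  \<open>k = a + r - p\<close> and its codomain is \<open>B\<^sub>a \<otimes> B\<^sub>r\<close>, so that domain and codomain determine \<open>b\<close>.
  The morphism is unique because its value at the highest weight element is forced, and it exists
  because moving the unmatched entries of the first column to the second one commutes with all
  \<open>e\<^sub>i\<close> and \<open>f\<^sub>i\<close>. There are \<open>(n + 1) choose 3\<close> triples \<open>a < p < r\<close>; the condition \<open>p \<le> k\<close> reads
  \<open>2 * p \<le> a + r\<close> and for fixed \<open>r\<close> it leaves \<open>r\<^sup>2 div 4\<close> pairs \<open>(a, p)\<close>.
\<close>

section \<open>String lengths\<close>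

lemma opow_0: "opow g 0 b = Some b"
  by (simp add: opow_def)

lemma opow_Suc: "opow g (Suc m) b = Option.bind (opow g m b) g"
  by (simp add: opow_def)

text \<open>Strings in a fundamental crystal have length at most one, so length 0 and length 1 are
  the only cases. The set of exponents is computed explicitly, which also gives the finiteness that
  \<open>Max\<close> relies on.\<close>

lemma Max_opow_0:
  assumes "g b = None"
  shows "Max {m. opow g m b \<noteq> None} = 0"
proof -
  have "opow g m b = (if m = 0 then Some b else None)" for m
    by (induction m) (auto simp: opow_0 opow_Suc assms)
  then have "{m. opow g m b \<noteq> None} = {0}" by auto
  then show ?thesis by simp
qed

lemma Max_opow_1:
  assumes "g b = Some b'" "g b' = None"
  shows "Max {m. opow g m b \<noteq> None} = 1"
proof -
  have "opow g m b = (if m = 0 then Some b else if m = 1 then Some b' else None)" for m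
    by (induction m) (auto simp: opow_0 opow_Suc assms)
  then have "{m. opow g m b \<noteq> None} = {0, 1}" by auto
  then show ?thesis by simp
qed

lemma epsilon_0: "eop C i b = None \<Longrightarrow> epsilon C i b = 0"
  and epsilon_1: "eop C i b = Some b' \<Longrightarrow> eop C i b' = None \<Longrightarrow> epsilon C i b = 1"
  and phi_0: "fop C i b = None \<Longrightarrow> phi C i b = 0"
  and phi_1: "fop C i b = Some b' \<Longrightarrow> fop C i b' = None \<Longrightarrow> phi C i b = 1"
  unfolding epsilon_def phi_def by (fact Max_opow_0 Max_opow_1)+

section \<open>Crystal operators on one column\<close>

text \<open>For \<open>i\<close> in \<open>{1..<n}\<close> these are the conditions
  \<open>\<epsilon>\<^sub>i = 1\<close> and \<open>\<phi>\<^sub>i = 1\<close>, stated for plain sets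
  without \<open>n\<close> and \<open>k\<close>, so that the sliding below is pure combinatorics of
  sets.\<close>

definition asc :: "nat \<Rightarrow> nat set \<Rightarrow> bool" where
  "asc i S \<longleftrightarrow> Suc i \<in> S \<and> i \<notin> S"

definition desc :: "nat \<Rightarrow> nat set \<Rightarrow> bool" where
  "desc i S \<longleftrightarrow> i \<in> S \<and> Suc i \<notin> S"

definition raise :: "nat \<Rightarrow> nat set \<Rightarrow> nat set" where
  "raise i S = insert i (S - {Suc i})"

definition lower :: "nat \<Rightarrow> nat set \<Rightarrow> nat set" where
  "lower i S = insert (Suc i) (S - {i})"

lemma raise_iff: "j \<in> raise i S \<longleftrightarrow> j = i \<or> j \<in> S \<and> j \<noteq> Suc i"
  by (auto simp: raise_def)

lemma lower_iff: "j \<in> lower i S \<longleftrightarrow> j = Suc i \<or> j \<in> S \<and> j \<noteq> i"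
  by (auto simp: lower_def)

lemma raise_lower: "desc i S \<Longrightarrow> raise i (lower i S) = S"
  and lower_raise: "asc i S \<Longrightarrow> lower i (raise i S) = S"
  by (auto simp: raise_def lower_def asc_def desc_def)

lemma fund_ops:
  "i \<in> {1..<n} \<Longrightarrow> eop (fund_crystal n k) i S = (if asc i S then Some (raise i S) else None)"
  "i \<in> {1..<n} \<Longrightarrow> fop (fund_crystal n k) i S = (if desc i S then Some (lower i S) else None)"
  by (auto simp: fund_crystal_def asc_def desc_def raise_def lower_def)

lemma fund_elts: "S \<in> elts (fund_crystal n k) \<longleftrightarrow> S \<subseteq> {1..n} \<and> card S = k"
  by (simp add: fund_crystal_def)

lemma fund_raise:
  assumes "i \<in> {1..<n}" "asc i S" "S \<in> elts (fund_crystal n k)"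
  shows "raise i S \<in> elts (fund_crystal n k)"
proof -
  have "finite S" using assms finite_subset by (auto simp: fund_elts)
  then have "card (raise i S) = card S"
    using assms(2) card_gt_0_iff[of S] by (auto simp: raise_def asc_def)
  then show ?thesis using assms by (auto simp: fund_elts raise_def asc_def)
qed

lemma fund_lower:
  assumes "i \<in> {1..<n}" "desc i S" "S \<in> elts (fund_crystal n k)"
  shows "lower i S \<in> elts (fund_crystal n k)"
proof -
  have "finite S" using assms finite_subset by (auto simp: fund_elts)
  then have "card (lower i S) = card S"
    using assms(2) card_gt_0_iff[of S] by (auto simp: lower_def desc_def)
  then show ?thesis using assms by (auto simp: fund_elts lower_def desc_def)
qed

lemma asc_raise: "\<not> asc i (raise i S)"
  and desc_raise: "desc i (raise i S)"
  and asc_lower: "asc i (lower i S)"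
  and desc_lower: "\<not> desc i (lower i S)"
  by (auto simp: asc_def desc_def raise_iff lower_iff)

lemma fund_epsilon: "i \<in> {1..<n} \<Longrightarrow> epsilon (fund_crystal n k) i S = of_bool (asc i S)"
  by (cases "asc i S") (simp_all add: fund_ops asc_raise epsilon_0 epsilon_1)

lemma fund_phi: "i \<in> {1..<n} \<Longrightarrow> phi (fund_crystal n k) i S = of_bool (desc i S)"
  by (cases "desc i S") (simp_all add: fund_ops desc_lower phi_0 phi_1)

section \<open>Tensor words of length at most two\<close>

lemma epsilon_empty_word: "epsilon (word_crystal n []) i z = 0"
  by (simp add: epsilon_0)

lemma single_ops:
  assumes "i \<in> {1..<n}"
  shows "eop (word_crystal n [k]) i [S] = (if asc i S then Some [raise i S] else None)"
    and "fop (word_crystal n [k]) i [S] = (if desc i S then Some [lower i S] else None)"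
  using assms epsilon_empty_word[of n i "[]"]
  by (simp_all add: tensor_cons_def fund_phi fund_ops)

lemma single_epsilon:
  assumes "i \<in> {1..<n}"
  shows "epsilon (word_crystal n [k]) i [S] = of_bool (asc i S)"
  using assms
  by (cases "asc i S")
    (simp_all add: single_ops asc_raise epsilon_0 epsilon_1[of _ _ _ "[raise i S]"] del: word_crystal.simps)

text \<open>As \<open>\<phi>\<^sub>i\<close> and \<open>\<epsilon>\<^sub>i\<close> only take the
  values 0 and 1, \<open>\<phi>\<^sub>i(S) < \<epsilon>\<^sub>i(T)\<close> means
  \<open>asc i T\<close> without \<open>desc i S\<close>, and
  \<open>\<phi>\<^sub>i(S) > \<epsilon>\<^sub>i(T)\<close> means \<open>desc i S\<close> without
  \<open>asc i T\<close>.\<close>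

lemma pair_ops:
  assumes "i \<in> {1..<n}"
  shows "eop (word_crystal n [p, k]) i [S, T] =
      (if asc i T \<and> \<not> desc i S then Some [S, raise i T]
       else if asc i S then Some [raise i S, T] else None)"
    and "fop (word_crystal n [p, k]) i [S, T] =
      (if desc i S \<and> \<not> asc i T then Some [lower i S, T]
       else if desc i T then Some [S, lower i T] else None)"
  using single_epsilon[OF assms, of k T] single_ops[OF assms, of k T] assms
  by (auto simp: tensor_cons_def[of _ "word_crystal n [k]"] word_crystal.simps(2)[of n p] fund_phi fund_ops
      simp del: word_crystal.simps)

lemma pair_elts:
  "x \<in> elts (word_crystal n [p, k]) \<longleftrightarrow>
    (\<exists>S T. x = [S, T] \<and> S \<in> elts (fund_crystal n p) \<and> T \<in> elts (fund_crystal n k))"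
  by (auto simp: tensor_cons_def)

lemma single_elts:
  "x \<in> elts (word_crystal n [k]) \<longleftrightarrow> (\<exists>S. x = [S] \<and> S \<in> elts (fund_crystal n k))"
  by (auto simp: tensor_cons_def)

lemma fund_wt: "wt (fund_crystal n k) S i =
    (if i \<in> {1..<n} then of_bool (i \<in> S) - of_bool (Suc i \<in> S) else 0)"
  by (simp add: fund_crystal_def)

lemma word_wt:
  "wt (word_crystal n []) z i = 0"
  "wt (word_crystal n [k]) [S] i = wt (fund_crystal n k) S i"
  "wt (word_crystal n [p, k]) [S, T] i = wt (fund_crystal n p) S i + wt (fund_crystal n k) T i"
  by (simp_all add: tensor_cons_def)

lemma pair_closed:
  assumes "i \<in> {1..<n}" "x \<in> elts (word_crystal n [p, k])"
    and "eop (word_crystal n [p, k]) i x = Some y \<or> fop (word_crystal n [p, k]) i x = Some y"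
  shows "y \<in> elts (word_crystal n [p, k])"
  using assms fund_raise[OF assms(1)] fund_lower[OF assms(1)]
  by (auto simp: pair_elts pair_ops split: if_splits simp del: word_crystal.simps)

text \<open>After a step the tensor rule selects the same factor for the way back. Hence no arrow
  enters a component from outside, which extension by zero requires.\<close>

lemma pair_inverse:
  assumes "i \<in> {1..<n}" "x \<in> elts (word_crystal n [p, k])"
  shows "eop (word_crystal n [p, k]) i x = Some y \<Longrightarrow> fop (word_crystal n [p, k]) i y = Some x"
    and "fop (word_crystal n [p, k]) i x = Some y \<Longrightarrow> eop (word_crystal n [p, k]) i y = Some x"
proof -
  obtain S T where [simp]: "x = [S, T]" using assms(2) by (auto simp: pair_elts simp del: word_crystal.simps)
  note L = asc_raise desc_raise asc_lower desc_lower
  have D: "asc i U \<Longrightarrow> \<not> desc i U" for U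
    by (auto simp: asc_def desc_def)
  show "eop (word_crystal n [p, k]) i x = Some y \<Longrightarrow> fop (word_crystal n [p, k]) i y = Some x"
    using assms(1) L D by (auto simp: pair_ops lower_raise split: if_splits simp del: word_crystal.simps)
  show "fop (word_crystal n [p, k]) i x = Some y \<Longrightarrow> eop (word_crystal n [p, k]) i y = Some x"
    using assms(1) L D by (auto simp: pair_ops raise_lower split: if_splits simp del: word_crystal.simps)
qed

section \<open>Sliding letters between two columns\<close>

text \<open>
  Reading the letters in increasing order, letters of \<open>T\<close> only are opening and letters of \<open>S\<close> only
  are closing brackets; \<open>open_brackets S T j\<close> is the number of unmatched opening ones among the
  letters up to \<open>j\<close>. The map \<open>slide\<close> moves the unmatched closing brackets from \<open>S\<close> to \<open>T\<close>; it is the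
  maximal power of the crystal operator of the \<open>gl\<^sub>2\<close> commuting with \<open>gl\<^sub>n\<close> by skew Howe duality.
\<close>

primrec open_brackets :: "nat set \<Rightarrow> nat set \<Rightarrow> nat \<Rightarrow> nat" where
  "open_brackets S T 0 = 0"
| "open_brackets S T (Suc j) =
    (if Suc j \<in> T \<and> Suc j \<notin> S then Suc (open_brackets S T j)
     else if Suc j \<in> S \<and> Suc j \<notin> T then open_brackets S T j - 1
     else open_brackets S T j)"

definition slide1 :: "nat set \<Rightarrow> nat set \<Rightarrow> nat set" where
  "slide1 S T = {j \<in> S. j \<in> T \<or> open_brackets S T (j - 1) > 0}"

definition slide2 :: "nat set \<Rightarrow> nat set \<Rightarrow> nat set" where
  "slide2 S T = T \<union> {j \<in> S. open_brackets S T (j - 1) = 0}"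

text \<open>Both recursions read the same letters except \<open>Suc m\<close> and
  \<open>Suc (Suc m)\<close>; once the counts agree again after these two, they agree forever. Only
  the count in between may differ.\<close>

lemma open_brackets_cong:
  assumes "\<And>j. j \<noteq> Suc m \<Longrightarrow> j \<noteq> Suc (Suc m) \<Longrightarrow> (j \<in> S' \<longleftrightarrow> j \<in> S) \<and> (j \<in> T' \<longleftrightarrow> j \<in> T)"
    and "open_brackets S' T' m = open_brackets S T m \<Longrightarrow>
      open_brackets S' T' (Suc (Suc m)) = open_brackets S T (Suc (Suc m))"
    and "j \<noteq> Suc m"
  shows "open_brackets S' T' j = open_brackets S T j"
proof -
  have le: "j \<le> m \<Longrightarrow> open_brackets S' T' j = open_brackets S T j" for j
    by (induction j) (auto simp: assms(1))
  have "open_brackets S' T' (Suc (Suc m) + d) = open_brackets S T (Suc (Suc m) + d)" for d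
  proof (induction d)
    case 0
    show ?case using assms(2) le by simp
  next
    case (Suc d)
    have "(Suc (Suc (Suc m) + d) \<in> S' \<longleftrightarrow> Suc (Suc (Suc m) + d) \<in> S) \<and>
          (Suc (Suc (Suc m) + d) \<in> T' \<longleftrightarrow> Suc (Suc (Suc m) + d) \<in> T)"
      by (rule assms(1)) auto
    then show ?case unfolding add_Suc_right open_brackets.simps(2)[of _ _ "Suc (Suc m) + d"]
      using Suc by presburger
  qed
  then show ?thesis using le[of j] assms(3)
    by (metis le_add_diff_inverse not_less_eq_eq order_antisym)
qed

text \<open>
  It suffices to compare the two letters \<open>i\<close> and \<open>i + 1\<close>, together with the number of open brackets
  after them.
\<close>

lemma slide_cong:
  assumes "\<And>j. j \<noteq> Suc m \<Longrightarrow> j \<noteq> Suc (Suc m) \<Longrightarrow> (j \<in> S' \<longleftrightarrow> j \<in> S) \<and> (j \<in> T' \<longleftrightarrow> j \<in> T)"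
    and "open_brackets S' T' m = open_brackets S T m \<Longrightarrow>
      open_brackets S' T' (Suc (Suc m)) = open_brackets S T (Suc (Suc m))"
    and "\<And>j. j \<noteq> Suc m \<Longrightarrow> j \<noteq> Suc (Suc m) \<Longrightarrow>
      (j \<in> A \<longleftrightarrow> j \<in> slide1 S T) \<and> (j \<in> B \<longleftrightarrow> j \<in> slide2 S T)"
    and "open_brackets S' T' m = open_brackets S T m \<Longrightarrow>
      (Suc m \<in> A \<longleftrightarrow> Suc m \<in> slide1 S' T') \<and> (Suc m \<in> B \<longleftrightarrow> Suc m \<in> slide2 S' T') \<and>
      (Suc (Suc m) \<in> A \<longleftrightarrow> Suc (Suc m) \<in> slide1 S' T') \<and>
      (Suc (Suc m) \<in> B \<longleftrightarrow> Suc (Suc m) \<in> slide2 S' T')"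
  shows "A = slide1 S' T' \<and> B = slide2 S' T'"
proof -
  have ob: "j \<noteq> Suc m \<Longrightarrow> open_brackets S' T' j = open_brackets S T j" for j
    using open_brackets_cong[of m S' S T' T j] assms(1,2) by blast
  have "(j \<in> A \<longleftrightarrow> j \<in> slide1 S' T') \<and> (j \<in> B \<longleftrightarrow> j \<in> slide2 S' T')" for j
  proof (cases "j = Suc m \<or> j = Suc (Suc m)")
    case True
    then show ?thesis using assms(4)[OF ob] by fastforce
  next
    case False
    then have "open_brackets S' T' (j - 1) = open_brackets S T (j - 1)" by (intro ob) auto
    then show ?thesis using False assms(1)[of j] assms(3)[of j] by (auto simp: slide1_def slide2_def)
  qed
  then show ?thesis by auto
qed

text \<open>The labels \<open>a\<close> and \<open>r\<close> are arbitrary because the operators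
  ignore them; that the slid columns have these sizes is shown later, along the component.\<close>

lemma fop_slide:
  assumes "i \<in> {1..<n}"
  shows "fop (word_crystal n [a, r]) i [slide1 S T, slide2 S T] =
    map_option (\<lambda>x. [slide1 (x ! 0) (x ! 1), slide2 (x ! 0) (x ! 1)]) (fop (word_crystal n [p, k]) i [S, T])"
proof -
  obtain m where i: "i = Suc m" using assms by (cases i) auto
  note defs = slide1_def slide2_def desc_def asc_def i
  \<comment> \<open>The cases record the factor on which \<open>f\<^sub>i\<close> acts before and
    after sliding: first to second, first to first, second to first, second to second, and zero. The
    factor changes exactly when the letter \<open>i\<close> (first case) or \<open>i + 1\<close>
    (third case) is an unmatched closing bracket that slides.\<close>
  consider "desc i S" "i \<notin> T" "Suc i \<notin> T" "open_brackets S T m = 0"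
    | "desc i S" "\<not> asc i T" "i \<in> T \<or> Suc i \<in> T \<or> open_brackets S T m > 0"
    | "desc i T" "i \<in> S" "Suc i \<in> S" "open_brackets S T m = 0"
    | "desc i T" "\<not> desc i S" "i \<notin> S \<or> Suc i \<notin> S \<or> open_brackets S T m > 0"
    | "\<not> (desc i S \<and> \<not> asc i T)" "\<not> desc i T"
    by (auto simp: asc_def desc_def)
  then show ?thesis
  proof cases
    case 1
    have "slide1 S T = slide1 (lower i S) T \<and> lower i (slide2 S T) = slide2 (lower i S) T"
      by (rule slide_cong[of m _ S T T]) (use 1 in \<open>auto simp: lower_iff defs\<close>)
    moreover have "\<not> (desc i (slide1 S T) \<and> \<not> asc i (slide2 S T))" "desc i (slide2 S T)"
      using 1 by (auto simp: defs)
    ultimately show ?thesis using 1 by (auto simp: pair_ops[OF assms] asc_def simp del: word_crystal.simps)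
  next
    case 2
    have "lower i (slide1 S T) = slide1 (lower i S) T \<and> slide2 S T = slide2 (lower i S) T"
      by (rule slide_cong[of m _ S T T]) (use 2 in \<open>auto simp: lower_iff defs\<close>)
    moreover have "desc i (slide1 S T)" "\<not> asc i (slide2 S T)"
      using 2 by (auto simp: defs)
    ultimately show ?thesis using 2 by (simp add: pair_ops[OF assms] del: word_crystal.simps)
  next
    case 3
    have "lower i (slide1 S T) = slide1 S (lower i T) \<and> slide2 S T = slide2 S (lower i T)"
      by (rule slide_cong[of m S S _ T]) (use 3 in \<open>auto simp: lower_iff defs\<close>)
    moreover have "desc i (slide1 S T)" "\<not> asc i (slide2 S T)" "\<not> desc i S"
      using 3 by (auto simp: defs)
    ultimately show ?thesis using 3 by (simp add: pair_ops[OF assms] del: word_crystal.simps)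
  next
    case 4
    have "slide1 S T = slide1 S (lower i T) \<and> lower i (slide2 S T) = slide2 S (lower i T)"
      by (rule slide_cong[of m S S _ T]) (use 4 in \<open>auto simp: lower_iff defs\<close>)
    moreover have "\<not> desc i (slide1 S T)" "desc i (slide2 S T)"
      using 4 by (auto simp: defs)
    ultimately show ?thesis using 4 by (simp add: pair_ops[OF assms] del: word_crystal.simps)
  next
    case 5
    have "\<not> (desc i (slide1 S T) \<and> \<not> asc i (slide2 S T))" "\<not> desc i (slide2 S T)"
      using 5 by (auto simp: defs split: if_splits)
    then show ?thesis using 5 by (auto simp add: pair_ops[OF assms] simp del: word_crystal.simps)
  qed
qed

lemma eop_slide:
  assumes "i \<in> {1..<n}"
  shows "eop (word_crystal n [a, r]) i [slide1 S T, slide2 S T] =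
    map_option (\<lambda>x. [slide1 (x ! 0) (x ! 1), slide2 (x ! 0) (x ! 1)]) (eop (word_crystal n [p, k]) i [S, T])"
proof -
  obtain m where i: "i = Suc m" using assms by (cases i) auto
  note defs = slide1_def slide2_def desc_def asc_def i
  \<comment> \<open>As for \<open>f\<^sub>i\<close>, but here the factor changes in the second and
    the third case.\<close>
  consider "asc i T" "\<not> desc i S" "i \<notin> S \<or> Suc i \<notin> S \<or> open_brackets S T m > 0"
    | "asc i T" "i \<in> S" "Suc i \<in> S" "open_brackets S T m = 0"
    | "asc i S" "i \<notin> T" "Suc i \<notin> T" "open_brackets S T m = 0"
    | "asc i S" "\<not> asc i T" "i \<in> T \<or> Suc i \<in> T \<or> open_brackets S T m > 0"
    | "\<not> (asc i T \<and> \<not> desc i S)" "\<not> asc i S"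
    by (auto simp: asc_def desc_def)
  then show ?thesis
  proof cases
    case 1
    have "slide1 S T = slide1 S (raise i T) \<and> raise i (slide2 S T) = slide2 S (raise i T)"
      by (rule slide_cong[of m S S _ T]) (use 1 in \<open>auto simp: raise_iff defs\<close>)
    moreover have "\<not> desc i (slide1 S T)" "asc i (slide2 S T)"
      using 1 by (auto simp: defs)
    ultimately show ?thesis using 1 by (simp add: pair_ops[OF assms] del: word_crystal.simps)
  next
    case 2
    have "raise i (slide1 S T) = slide1 S (raise i T) \<and> slide2 S T = slide2 S (raise i T)"
      by (rule slide_cong[of m S S _ T]) (use 2 in \<open>auto simp: raise_iff defs\<close>)
    moreover have "asc i (slide1 S T)" "\<not> asc i (slide2 S T)" "\<not> desc i S"
      using 2 by (auto simp: defs)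
    ultimately show ?thesis using 2 by (simp add: pair_ops[OF assms] del: word_crystal.simps)
  next
    case 3
    have "slide1 S T = slide1 (raise i S) T \<and> raise i (slide2 S T) = slide2 (raise i S) T"
      by (rule slide_cong[of m _ S T T]) (use 3 in \<open>auto simp: raise_iff defs\<close>)
    moreover have "\<not> desc i (slide1 S T)" "asc i (slide2 S T)" "\<not> asc i T"
      using 3 by (auto simp: defs)
    ultimately show ?thesis using 3 by (simp add: pair_ops[OF assms] del: word_crystal.simps)
  next
    case 4
    have "raise i (slide1 S T) = slide1 (raise i S) T \<and> slide2 S T = slide2 (raise i S) T"
      by (rule slide_cong[of m _ S T T]) (use 4 in \<open>auto simp: raise_iff defs\<close>)
    moreover have "asc i (slide1 S T)" "\<not> asc i (slide2 S T)"
      using 4 by (auto simp: defs)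
    ultimately show ?thesis using 4 by (simp add: pair_ops[OF assms] del: word_crystal.simps)
  next
    case 5
    have "\<not> (asc i (slide2 S T) \<and> \<not> desc i (slide1 S T))" "\<not> asc i (slide1 S T)"
      using 5 by (auto simp: defs split: if_splits)
    then show ?thesis using 5 by (auto simp add: pair_ops[OF assms] simp del: word_crystal.simps)
  qed
qed

definition slide :: "nat set list \<Rightarrow> nat set list" where
  "slide x = [slide1 (x ! 0) (x ! 1), slide2 (x ! 0) (x ! 1)]"

lemma slide_ops:
  assumes "i \<in> {1..<n}" "x \<in> elts (word_crystal n [p, k])"
  shows "eop (word_crystal n [a, r]) i (slide x) = map_option slide (eop (word_crystal n [p, k]) i x)"
    and "fop (word_crystal n [a, r]) i (slide x) = map_option slide (fop (word_crystal n [p, k]) i x)"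
  using assms eop_slide[OF assms(1)] fop_slide[OF assms(1)]
  by (auto simp: pair_elts slide_def[abs_def] simp del: word_crystal.simps)

text \<open>Only letters of \<open>S\<close> missing from \<open>T\<close> move, so the multiplicity
  of each letter in the pair of columns is preserved.\<close>

lemma slide_wt:
  assumes "x \<in> elts (word_crystal n [p, k])"
  shows "wt (word_crystal n [a, r]) (slide x) = wt (word_crystal n [p, k]) x"
  using assms
  by (auto simp: pair_elts slide_def slide1_def slide2_def word_wt fund_wt simp del: word_crystal.simps)

section \<open>Removal of trivial tensor factors\<close>

text \<open>The tensor factors \<open>B\<^sub>0\<close> and \<open>B\<^sub>n\<close> are trivial and do not occur in words.\<close>

definition trim :: "nat \<Rightarrow> nat \<Rightarrow> nat \<Rightarrow> 'a \<Rightarrow> 'a \<Rightarrow> 'a list" where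
  "trim n a r x y = (if a = 0 then [] else [x]) @ (if r = n then [] else [y])"

definition trim_elt :: "nat \<Rightarrow> nat \<Rightarrow> nat \<Rightarrow> nat set list \<Rightarrow> nat set list" where
  "trim_elt n a r x = trim n a r (x ! 0) (x ! 1)"

lemma fund_elts_trivial:
  "S \<in> elts (fund_crystal n 0) \<longleftrightarrow> S = {}"
  "S \<in> elts (fund_crystal n n) \<longleftrightarrow> S = {1..n}"
proof -
  show "S \<in> elts (fund_crystal n 0) \<longleftrightarrow> S = {}"
    using finite_subset[of S "{1..n}"] by (auto simp: fund_elts)
  show "S \<in> elts (fund_crystal n n) \<longleftrightarrow> S = {1..n}"
    using card_subset_eq[of "{1..n}" S] by (auto simp: fund_elts)
qed

lemma trivial_asc_desc:
  "\<not> asc i {}" "\<not> desc i {}"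
  "i \<in> {1..<n} \<Longrightarrow> \<not> asc i {1..n}" "i \<in> {1..<n} \<Longrightarrow> \<not> desc i {1..n}"
  by (auto simp: asc_def desc_def)

text \<open>The columns \<open>{}\<close> and \<open>{1..n}\<close> have neither ascents nor
  descents, so the operators always act as if that factor were absent.\<close>

lemma trim_ops:
  assumes "i \<in> {1..<n}" "x \<in> elts (word_crystal n [a, r])"
  shows "eop (word_crystal n (trim n a r a r)) i (trim_elt n a r x) =
      map_option (trim_elt n a r) (eop (word_crystal n [a, r]) i x)"
    and "fop (word_crystal n (trim n a r a r)) i (trim_elt n a r x) =
      map_option (trim_elt n a r) (fop (word_crystal n [a, r]) i x)"
proof -
  obtain A B where x: "x = [A, B]" "A \<in> elts (fund_crystal n a)" "B \<in> elts (fund_crystal n r)"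
    using assms(2) by (auto simp: pair_elts simp del: word_crystal.simps)
  have A: "\<not> asc i A \<and> \<not> desc i A" if "a = 0"
    using x that by (simp add: fund_elts_trivial trivial_asc_desc)
  have B: "\<not> asc i B \<and> \<not> desc i B" if "r = n"
    using x that assms(1) trivial_asc_desc(3,4)[of i n] by (simp add: fund_elts_trivial)
  have E: "eop (word_crystal n []) i z = None" "fop (word_crystal n []) i z = None" for z
    by simp_all
  show "eop (word_crystal n (trim n a r a r)) i (trim_elt n a r x) =
      map_option (trim_elt n a r) (eop (word_crystal n [a, r]) i x)"
    and "fop (word_crystal n (trim n a r a r)) i (trim_elt n a r x) =
      map_option (trim_elt n a r) (fop (word_crystal n [a, r]) i x)"
    using A B by (auto simp: E x(1) trim_elt_def trim_def pair_ops[OF assms(1)] single_ops[OF assms(1)]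
        simp del: word_crystal.simps)
qed

lemma trim_wt:
  assumes "x \<in> elts (word_crystal n [a, r])"
  shows "wt (word_crystal n (trim n a r a r)) (trim_elt n a r x) = wt (word_crystal n [a, r]) x"
proof -
  obtain A B where x: "x = [A, B]" "A \<in> elts (fund_crystal n a)" "B \<in> elts (fund_crystal n r)"
    using assms by (auto simp: pair_elts simp del: word_crystal.simps)
  have A: "wt (fund_crystal n a) A = (\<lambda>_. 0)" if "a = 0"
    using x that by (auto simp: fund_elts_trivial fund_wt)
  have B: "wt (fund_crystal n r) B = (\<lambda>_. 0)" if "r = n"
    using x that by (auto simp: fund_elts_trivial fund_wt)
  show ?thesis
    using A B by (auto simp: x(1) trim_elt_def trim_def word_wt simp del: word_crystal.simps)
qed

lemma trim_elts: "elts (word_crystal n (trim n a r a r)) = trim_elt n a r ` elts (word_crystal n [a, r])"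
proof -
  have E: "elts (word_crystal n []) = {[]}" by simp
  have "elts (word_crystal n [a, r]) =
      (\<lambda>(A, B). [A, B]) ` (elts (fund_crystal n a) \<times> elts (fund_crystal n r))"
    by (auto simp: pair_elts simp del: word_crystal.simps)
  then have "trim_elt n a r ` elts (word_crystal n [a, r]) =
      (\<lambda>(A, B). trim n a r A B) ` (elts (fund_crystal n a) \<times> elts (fund_crystal n r))"
    by (simp add: image_image trim_elt_def case_prod_beta del: word_crystal.simps)
  also have "\<dots> = {trim n a r A B |A B. A \<in> elts (fund_crystal n a) \<and> B \<in> elts (fund_crystal n r)}"
    by auto
  also have "\<dots> = elts (word_crystal n (trim n a r a r))"
    by (cases "a = 0"; cases "r = n")
      (auto simp: E trim_def pair_elts single_elts fund_elts_trivial simp del: word_crystal.simps)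
  finally show ?thesis by (rule sym)
qed

section \<open>Elements of highest weight\<close>

text \<open>Going down from the maximum, each letter forces the one below it, as there would be an
  ascent otherwise. An ascent at \<open>l\<close> itself is allowed, so that the lemma applies to
  the part of a column above its ascent.\<close>

lemma no_asc_interval:
  assumes "X \<subseteq> {Suc l..u}" "l \<le> u" "\<And>i. l < i \<Longrightarrow> i < u \<Longrightarrow> \<not> asc i X"
  shows "\<exists>r. l \<le> r \<and> r \<le> u \<and> X = {Suc l..r}"
proof (cases "X = {}")
  case True
  then show ?thesis using assms(2) by (intro exI[of _ l]) auto
next
  case False
  have fin: "finite X" using assms(1) finite_subset by blast
  define r where "r = Max X"
  have r: "r \<in> X" using fin False by (simp add: r_def)
  have "j \<in> X" if "l < j" "j \<le> r" for j
    using that(2)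
  proof (induction rule: inc_induct)
    case base
    show ?case by (rule r)
  next
    case (step m)
    then have "l < m" "m < u" using that r assms(1) by auto
    then show ?case using assms(3)[of m] step by (auto simp: asc_def)
  qed
  moreover have "j \<le> r" if "j \<in> X" for j using fin that by (simp add: r_def)
  ultimately have "X = {Suc l..r}" using assms(1) by fastforce
  then show ?thesis using r assms(1) by (intro exI[of _ r]) auto
qed

lemma no_asc_initial:
  assumes "X \<in> elts (fund_crystal n k)" "\<And>i. i \<in> {1..<n} \<Longrightarrow> \<not> asc i X"
  shows "X = {1..k}"
  using no_asc_interval[of X 0 n] assms by (auto simp: fund_elts)

lemma initial_fund_elts: "k \<le> n \<Longrightarrow> {1..k} \<in> elts (fund_crystal n k)"
  by (auto simp: fund_elts)

lemma initial_not_asc: "i \<in> {1..<n} \<Longrightarrow> \<not> asc i {1..k}"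
  by (auto simp: asc_def)

lemma fund_wt_initial: "wt (fund_crystal n k) {1..k} i = of_bool (i = k \<and> i \<in> {1..<n})"
  by (auto simp: fund_wt)

text \<open>An ascent of the first column always makes \<open>e\<^sub>i\<close> act, so that column
  is \<open>{1..a}\<close>. The second one then has the \<open>r\<close>-th fundamental weight,
  while an ascent would give it a coordinate -1.\<close>

lemma pair_highest_unique:
  assumes "highest_weight_element n (word_crystal n [a, r]) x"
    and "wt (word_crystal n [a, r]) x = (\<lambda>i. of_bool (i \<in> {1..<n} \<and> i = a) + of_bool (i \<in> {1..<n} \<and> i = r))"
  shows "x = [{1..a}, {1..r}]"
proof -
  obtain A B where x: "x = [A, B]" "A \<in> elts (fund_crystal n a)" "B \<in> elts (fund_crystal n r)"
    using assms(1) by (auto simp: pair_elts highest_weight_element_def simp del: word_crystal.simps)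
  have "\<not> asc i A" if "i \<in> {1..<n}" for i
    using assms(1) pair_ops(1)[OF that, of a r A B] that
    by (auto simp: highest_weight_element_def x(1) simp del: word_crystal.simps split: if_splits)
  then have A: "A = {1..a}" using no_asc_initial x(2) by blast
  have "\<not> asc i B" if "i \<in> {1..<n}" for i
  proof -
    have "wt (fund_crystal n r) B i = of_bool (i = r)"
      using fun_cong[OF assms(2), of i] that fund_wt_initial[of n a i]
      by (simp add: x(1) A word_wt del: word_crystal.simps)
    then show ?thesis using that by (auto simp: fund_wt asc_def of_bool_def split: if_splits)
  qed
  then have B: "B = {1..r}" using no_asc_initial x(3) by blast
  show ?thesis using x(1) A B by simp
qed

lemma pair_initial:
  assumes "a \<le> n" "r \<le> n"
  shows "highest_weight_element n (word_crystal n [a, r]) [{1..a}, {1..r}]"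
    and "wt (word_crystal n [a, r]) [{1..a}, {1..r}] =
      (\<lambda>i. of_bool (i \<in> {1..<n} \<and> i = a) + of_bool (i \<in> {1..<n} \<and> i = r))"
  using assms initial_not_asc initial_fund_elts[of _ n] fund_wt_initial[of n a] fund_wt_initial[of n r]
  by (auto simp: highest_weight_element_def pair_elts pair_ops word_wt fun_eq_iff
      simp del: word_crystal.simps)

lemma trim_fund_weight:
  assumes "a < n" "r \<le> n" "0 < r"
  shows "(\<lambda>j. \<Sum>k\<leftarrow>trim n a r a r. fund_weight k j) =
    (\<lambda>i. of_bool (i \<in> {1..<n} \<and> i = a) + of_bool (i \<in> {1..<n} \<and> i = r))"
  using assms by (auto simp: trim_def fund_weight_def)

text \<open>This makes the \<open>THE\<close> in \<open>highest_element\<close> well defined, and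
  later pins down the value of an atom at the generator of its component.\<close>

lemma trim_highest:
  assumes "a < r" "r \<le> n"
  shows "highest_weight_element n (word_crystal n (trim n a r a r)) h \<and>
      wt (word_crystal n (trim n a r a r)) h = (\<lambda>j. \<Sum>k\<leftarrow>trim n a r a r. fund_weight k j) \<longleftrightarrow>
    h = trim n a r {1..a} {1..r}" (is "?P h \<longleftrightarrow> _")
proof
  have tr: "highest_weight_element n (word_crystal n (trim n a r a r)) (trim_elt n a r x) \<longleftrightarrow>
      highest_weight_element n (word_crystal n [a, r]) x"
    if "x \<in> elts (word_crystal n [a, r])" for x
    using that trim_ops(1)[OF _ that] unfolding highest_weight_element_def trim_elts by simp
  have w: "(\<lambda>j. \<Sum>k\<leftarrow>trim n a r a r. fund_weight k j) =
    (\<lambda>i. of_bool (i \<in> {1..<n} \<and> i = a) + of_bool (i \<in> {1..<n} \<and> i = r))"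
    using assms by (intro trim_fund_weight) auto
  {
    assume h: "?P h"
    then obtain x where x: "h = trim_elt n a r x" "x \<in> elts (word_crystal n [a, r])"
      unfolding highest_weight_element_def trim_elts by auto
    have "x = [{1..a}, {1..r}]"
      using h x tr trim_wt[OF x(2)] unfolding w by (intro pair_highest_unique) auto
    then show "h = trim n a r {1..a} {1..r}" by (simp add: x(1) trim_elt_def)
  }
  {
    assume h: "h = trim n a r {1..a} {1..r}"
    have x: "[{1..a}, {1..r}] \<in> elts (word_crystal n [a, r])"
      using pair_initial(1)[of a n r] assms by (simp add: highest_weight_element_def del: word_crystal.simps)
    have "h = trim_elt n a r [{1..a}, {1..r}]" by (simp add: h trim_elt_def)
    then show "?P h"
      using tr[OF x] trim_wt[OF x] pair_initial[of a n r] assms unfolding w by simp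
  }
qed

lemma highest_element_trim:
  assumes "a < r" "r \<le> n"
  shows "highest_element n (trim n a r a r) = trim n a r {1..a} {1..r}"
  unfolding highest_element_def by (subst trim_highest[OF assms]) simp

lemma highest_element_single:
  assumes "p \<in> {1..<n}"
  shows "highest_element n [p] = [{1..p}]"
  using highest_element_trim[of 0 p n] assms by (simp add: trim_def)

section \<open>Components and strict morphisms\<close>

lemma component_self: "x \<in> component n C x"
  by (simp add: component_def)

lemma component_step:
  assumes "x \<in> component n C x0" "i \<in> {1..<n}" "eop C i x = Some y \<or> fop C i x = Some y"
  shows "y \<in> component n C x0"
proof -
  have "(x, y) \<in> {(u, v). \<exists>i\<in>{1..<n}. eop C i u = Some v \<or> fop C i u = Some v}"
    using assms(2,3) by blast
  moreover have "(x0, x) \<in> {(u, v). \<exists>i\<in>{1..<n}. eop C i u = Some v \<or> fop C i u = Some v}\<^sup>*"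
    using assms(1) by (simp add: component_def)
  ultimately show ?thesis by (simp add: component_def rtrancl.rtrancl_into_rtrancl)
qed

lemma component_induct [consumes 1, case_names base step]:
  assumes "x \<in> component n C x0" "P x0"
    and "\<And>x y i. x \<in> component n C x0 \<Longrightarrow> P x \<Longrightarrow> i \<in> {1..<n} \<Longrightarrow>
      eop C i x = Some y \<or> fop C i x = Some y \<Longrightarrow> P y"
  shows "P x"
proof -
  have "(x0, x) \<in> {(u, v). \<exists>i\<in>{1..<n}. eop C i u = Some v \<or> fop C i u = Some v}\<^sup>*"
    using assms(1) by (simp add: component_def)
  then show ?thesis
  proof (induction rule: rtrancl_induct)
    case base
    show ?case by (rule assms(2))
  next
    case (step y z)
    then show ?case using assms(3)[of y] by (auto simp: component_def)
  qed
qed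

lemma Max_opow_intertwine:
  assumes "\<And>x y. x \<in> K \<Longrightarrow> g x = Some y \<Longrightarrow> y \<in> K"
    and "\<And>x. x \<in> K \<Longrightarrow> g' (\<Phi> x) = map_option \<Phi> (g x)"
    and "x \<in> K"
  shows "Max {m. opow g' m (\<Phi> x) \<noteq> None} = Max {m. opow g m x \<noteq> None}"
proof -
  have "opow g' m (\<Phi> x) = map_option \<Phi> (opow g m x) \<and> (\<forall>y. opow g m x = Some y \<longrightarrow> y \<in> K)" for m
  proof (induction m)
    case 0
    show ?case by (simp add: opow_0 assms(3))
  next
    case (Suc m)
    then show ?case using assms(1,2) by (cases "opow g m x") (auto simp: opow_Suc)
  qed
  then show ?thesis by simp
qed

text \<open>Compatibility is also required at elements outside \<open>K\<close>, where the morphism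
  is zero; hence arrows must not lead into \<open>K\<close> either.\<close>

lemma crystal_morphism_extend_by_None:
  assumes sub: "K \<subseteq> elts C"
    and closed: "\<And>x y i. x \<in> K \<Longrightarrow> i \<in> {1..<n} \<Longrightarrow> eop C i x = Some y \<or> fop C i x = Some y \<Longrightarrow> y \<in> K"
    and coclosed: "\<And>x y i. x \<in> elts C \<Longrightarrow> y \<in> K \<Longrightarrow> i \<in> {1..<n} \<Longrightarrow>
      eop C i x = Some y \<or> fop C i x = Some y \<Longrightarrow> x \<in> K"
    and elts: "\<And>x. x \<in> K \<Longrightarrow> \<Phi> x \<in> elts D"
    and wt: "\<And>x. x \<in> K \<Longrightarrow> wt D (\<Phi> x) = wt C x"
    and e: "\<And>x i. x \<in> K \<Longrightarrow> i \<in> {1..<n} \<Longrightarrow> eop D i (\<Phi> x) = map_option \<Phi> (eop C i x)"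
    and f: "\<And>x i. x \<in> K \<Longrightarrow> i \<in> {1..<n} \<Longrightarrow> fop D i (\<Phi> x) = map_option \<Phi> (fop C i x)"
  shows "crystal_morphism n C D (\<lambda>x. if x \<in> K then Some (\<Phi> x) else None)"
proof -
  have eps: "epsilon D i (\<Phi> x) = epsilon C i x" and phi: "phi D i (\<Phi> x) = phi C i x"
    if "x \<in> K" "i \<in> {1..<n}" for x i
    unfolding epsilon_def phi_def
    by (rule Max_opow_intertwine[of K]; use closed e f that in blast)+
  have "Option.bind (eop C i x) (\<lambda>x. if x \<in> K then Some (\<Phi> x) else None) =
      Option.bind (if x \<in> K then Some (\<Phi> x) else None) (eop D i)"
    if "x \<in> elts C" "i \<in> {1..<n}" for x i
    using closed[of x i] coclosed[of x _ i] e[of x i] that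
    by (cases "eop C i x"; cases "x \<in> K") auto
  moreover have "Option.bind (fop C i x) (\<lambda>x. if x \<in> K then Some (\<Phi> x) else None) =
      Option.bind (if x \<in> K then Some (\<Phi> x) else None) (fop D i)"
    if "x \<in> elts C" "i \<in> {1..<n}" for x i
    using closed[of x i] coclosed[of x _ i] f[of x i] that
    by (cases "fop C i x"; cases "x \<in> K") auto
  ultimately show ?thesis
    unfolding crystal_morphism_def using sub elts wt eps phi by auto
qed

lemma component_image:
  assumes e: "\<And>x i. x \<in> component n C x0 \<Longrightarrow> i \<in> {1..<n} \<Longrightarrow> eop D i (\<Phi> x) = map_option \<Phi> (eop C i x)"
    and f: "\<And>x i. x \<in> component n C x0 \<Longrightarrow> i \<in> {1..<n} \<Longrightarrow> fop D i (\<Phi> x) = map_option \<Phi> (fop C i x)"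
  shows "\<Phi> ` component n C x0 = component n D (\<Phi> x0)"
proof (intro equalityI subsetI)
  fix y assume "y \<in> \<Phi> ` component n C x0"
  then obtain x where "y = \<Phi> x" "x \<in> component n C x0" by blast
  from this(2) show "y \<in> component n D (\<Phi> x0)" unfolding \<open>y = \<Phi> x\<close>
  proof (induction rule: component_induct)
    case base
    show ?case by (rule component_self)
  next
    case (step x y i)
    then show ?case using e[of x i] f[of x i] component_step[of "\<Phi> x" n D "\<Phi> x0" i "\<Phi> y"] by auto
  qed
next
  fix y assume "y \<in> component n D (\<Phi> x0)"
  then show "y \<in> \<Phi> ` component n C x0"
  proof (induction rule: component_induct)
    case base
    show ?case by (simp add: component_self)
  next
    case (step y z i)
    then obtain x where x: "y = \<Phi> x" "x \<in> component n C x0" by blast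
    \<comment> \<open>An arrow starting at an image \<open>\<Phi> x\<close> lifts to an arrow at
      \<open>x\<close>, since the operator of \<open>D\<close> there is the image of the operator of
      \<open>C\<close>.\<close>
    then obtain x' where "z = \<Phi> x'" "eop C i x = Some x' \<or> fop C i x = Some x'"
      using step e[of x i] f[of x i] by auto
    then show ?case using component_step[OF x(2) \<open>i \<in> {1..<n}\<close>] by blast
  qed
qed

text \<open>Strictness propagates values along arrows: the value at \<open>x\<close> determines the
  value at each neighbour of \<open>x\<close>.\<close>

lemma crystal_morphism_eqI:
  assumes m: "crystal_morphism n C D \<psi>" "crystal_morphism n C D \<psi>'"
    and sub: "component n C x0 \<subseteq> elts C"
    and x0: "\<psi> x0 = \<psi>' x0"
    and N: "\<forall>x \<in> elts C - component n C x0. \<psi> x = None" "\<forall>x \<in> elts C - component n C x0. \<psi>' x = None"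
  shows "\<psi> = \<psi>'"
proof
  fix x
  have "\<psi> x = \<psi>' x" if "x \<in> component n C x0"
    using that
  proof (induction rule: component_induct)
    case base
    show ?case by (rule x0)
  next
    case (step x y i)
    then have "x \<in> elts C" using sub by blast
    then have "Option.bind (eop C i x) \<psi> = Option.bind (eop C i x) \<psi>'"
      "Option.bind (fop C i x) \<psi> = Option.bind (fop C i x) \<psi>'"
      using m \<open>i \<in> {1..<n}\<close> \<open>\<psi> x = \<psi>' x\<close> unfolding crystal_morphism_def by simp_all
    then show ?case using step by auto
  qed
  moreover have "\<psi> x = \<psi>' x" if "x \<notin> elts C"
    using m that unfolding crystal_morphism_def by metis
  ultimately show "\<psi> x = \<psi>' x" using N by (metis DiffI)
qed

section \<open>Columns with exactly one ascent\<close>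

definition two_block :: "nat \<Rightarrow> nat \<Rightarrow> nat \<Rightarrow> nat set" where
  "two_block a p r = {1..a} \<union> {Suc p..r}"

lemma two_block_fund_elts:
  assumes "a < p" "p < r" "r \<le> n"
  shows "two_block a p r \<in> elts (fund_crystal n (a + r - p))"
proof -
  have "card (two_block a p r) = a + (r - p)"
    unfolding two_block_def using assms by (subst card_Un_disjoint) auto
  then show ?thesis using assms by (auto simp: fund_elts two_block_def)
qed

lemma concat_replicate_of_bool: "concat (map (\<lambda>i. replicate (of_bool (P i)) i) xs) = filter P xs"
  by (induction xs) auto

lemma epsilon_word_eq: "epsilon_word n k b = filter (\<lambda>i. asc i b) [1..<n]"
proof -
  have "map (\<lambda>i. replicate (epsilon (fund_crystal n k) i b) i) [1..<n] =
      map (\<lambda>i. replicate (of_bool (asc i b)) i) [1..<n]"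
    by (intro map_cong) (simp_all add: fund_epsilon)
  then show ?thesis unfolding epsilon_word_def by (simp only: concat_replicate_of_bool)
qed

lemma delta_word_eq: "delta_word n k b = filter (\<lambda>i. desc i b) [1..<n]"
proof -
  have "map (\<lambda>i. replicate (phi (fund_crystal n k) i b) i) [1..<n] =
      map (\<lambda>i. replicate (of_bool (desc i b)) i) [1..<n]"
    by (intro map_cong) (simp_all add: fund_phi)
  then show ?thesis unfolding delta_word_def by (simp only: concat_replicate_of_bool)
qed

lemma two_block_words:
  assumes "a < p" "p < r" "r \<le> n"
  shows "epsilon_word n k (two_block a p r) = [p]"
    and "delta_word n k (two_block a p r) = trim n a r a r"
proof -
  show "epsilon_word n k (two_block a p r) = [p]"
    unfolding epsilon_word_eq
    \<comment> \<open>Both words are strictly increasing, so comparing their sets of labels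
      suffices.\<close>
    by (rule sorted_distinct_set_unique) (use assms in \<open>auto simp: two_block_def asc_def sorted_wrt_filter\<close>)
  show "delta_word n k (two_block a p r) = trim n a r a r"
    unfolding delta_word_eq
    by (rule sorted_distinct_set_unique)
      (use assms in \<open>auto simp: two_block_def desc_def trim_def sorted_wrt_filter split: if_splits\<close>)
qed

text \<open>Cut at its only ascent \<open>p\<close>, the column falls into two parts without inner
  ascents, which are intervals starting at 1 and at \<open>p + 1\<close>. The ascent gives
  \<open>p \<notin> b\<close> and \<open>Suc p \<in> b\<close>, whence \<open>a < p\<close> and
  \<open>p < r\<close>.\<close>

lemma epsilon_word_singleton:
  assumes "b \<in> elts (fund_crystal n k)" "epsilon_word n k b = [p]"
  shows "\<exists>a r. a < p \<and> p < r \<and> r \<le> n \<and> b = two_block a p r \<and> k = a + r - p"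
proof -
  have "set (filter (\<lambda>i. asc i b) [1..<n]) = {p}"
    using assms(2) by (simp add: epsilon_word_eq del: set_filter)
  then have asc_iff: "i \<in> {1..<n} \<and> asc i b \<longleftrightarrow> i = p" for i by auto
  then have p: "p \<in> {1..<n}" "asc p b" by auto
  have b: "b \<subseteq> {1..n}" using assms(1) by (simp add: fund_elts)
  have "\<exists>a\<ge>0. a \<le> p \<and> b \<inter> {1..p} = {Suc 0..a}"
  proof (rule no_asc_interval)
    fix i assume "0 < i" "i < p"
    then show "\<not> asc i (b \<inter> {1..p})" using asc_iff[of i] p by (auto simp: asc_def)
  qed auto
  then obtain a where a: "a \<le> p" "b \<inter> {1..p} = {Suc 0..a}" by blast
  have "\<exists>r\<ge>p. r \<le> n \<and> b \<inter> {Suc p..n} = {Suc p..r}"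
  proof (rule no_asc_interval)
    fix i assume "p < i" "i < n"
    then show "\<not> asc i (b \<inter> {Suc p..n})" using asc_iff[of i] p by (auto simp: asc_def)
  qed (use p in auto)
  then obtain r where r: "p \<le> r" "r \<le> n" "b \<inter> {Suc p..n} = {Suc p..r}" by blast
  have "p \<notin> {Suc 0..a}" unfolding a(2)[symmetric] using p by (auto simp: asc_def)
  then have "a \<noteq> p" using p(1) by auto
  moreover have "Suc p \<in> {Suc p..r}" unfolding r(3)[symmetric] using p by (auto simp: asc_def)
  then have "r \<noteq> p" by auto
  moreover have "b = (b \<inter> {1..p}) \<union> (b \<inter> {Suc p..n})" using b by force
  then have b_eq: "b = two_block a p r" using a r by (simp add: two_block_def)
  ultimately have "a < p" "p < r" using a r by auto
  moreover have "k = a + r - p"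
    using two_block_fund_elts[OF \<open>a < p\<close> \<open>p < r\<close> r(2)] assms(1) b_eq by (simp add: fund_elts)
  ultimately show ?thesis using b_eq r(2) by blast
qed

section \<open>Existence and uniqueness of the two-strand atoms\<close>

text \<open>Up to \<open>p\<close> the second column is contained in the first, so there is no
  opening bracket. The letters from \<open>a + 1\<close> to \<open>p\<close> are therefore unmatched
  and fill the gap of the second column.\<close>

lemma slide_two_block:
  assumes "a < p" "p < r"
  shows "slide [{1..p}, two_block a p r] = [{1..a}, {1..r}]"
proof -
  have "open_brackets {1..p} (two_block a p r) j = 0" if "j \<le> p" for j
    using that assms by (induction j) (auto simp: two_block_def)
  then show ?thesis
    using assms by (auto simp: slide_def slide1_def slide2_def two_block_def)
qed

lemma two_block_atom:
  assumes "a < p" "p < r" "r \<le> n"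
  shows "\<exists>!\<psi>. is_atom_map n (a + r - p) (two_block a p r) \<psi>"
proof -
  define C where "C = word_crystal n [p, a + r - p]"
  define P where "P = word_crystal n [a, r]"
  define D where "D = word_crystal n (trim n a r a r)"
  define x0 where "x0 = [{1..p}, two_block a p r]"
  define h where "h = trim n a r {1..a} {1..r}"
  define K where "K = component n C x0"
  define \<Phi> where "\<Phi> = (\<lambda>x. trim_elt n a r (slide x))"
  have p: "p \<in> {1..<n}" using assms by auto
  have x0: "x0 \<in> elts C"
    using two_block_fund_elts[OF assms] initial_fund_elts[of p n] assms
    by (simp add: x0_def C_def pair_elts del: word_crystal.simps)
  have sx0: "slide x0 = [{1..a}, {1..r}]"
    using slide_two_block assms by (simp add: x0_def)
  have \<Phi>x0: "\<Phi> x0 = h"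
    by (simp add: \<Phi>_def sx0 trim_elt_def h_def)
  have atom_iff: "is_atom_map n (a + r - p) (two_block a p r) \<psi> \<longleftrightarrow>
      crystal_morphism n C D \<psi> \<and> \<psi> ` K = Some ` component n D h \<and> (\<forall>x \<in> elts C - K. \<psi> x = None)" for \<psi>
    using assms
    by (simp add: is_atom_map_def Let_def two_block_words[OF assms] highest_element_single[OF p]
        top_component_def highest_element_trim C_def D_def x0_def h_def K_def del: word_crystal.simps)
  \<comment> \<open>Sliding yields columns of sizes \<open>a\<close> and \<open>r\<close> at the
    generator, and the operators preserve sizes; this carries membership through the whole
    component.\<close>
  have K: "x \<in> elts C \<and> slide x \<in> elts P" if "x \<in> K" for x
    using that unfolding K_def
  proof (induction rule: component_induct)
    case base
    show ?case using x0 pair_initial(1)[of a n r] assms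
      by (simp add: sx0 P_def highest_weight_element_def del: word_crystal.simps)
  next
    case (step x y i)
    then have "eop P i (slide x) = Some (slide y) \<or> fop P i (slide x) = Some (slide y)"
      unfolding C_def P_def using slide_ops[of i n x] by auto
    then show ?case using step pair_closed unfolding C_def P_def by blast
  qed
  have sub: "K \<subseteq> elts C" using K by blast
  have e: "eop D i (\<Phi> x) = map_option \<Phi> (eop C i x)"
    and f: "fop D i (\<Phi> x) = map_option \<Phi> (fop C i x)" if "x \<in> K" "i \<in> {1..<n}" for x i
    using trim_ops[OF that(2), of "slide x" a r] slide_ops[OF that(2), of x p "a + r - p" a r] K[OF that(1)]
    by (simp_all add: C_def D_def P_def \<Phi>_def option.map_comp comp_def del: word_crystal.simps)
  have w: "wt D (\<Phi> x) = wt C x" if "x \<in> K" for x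
    using trim_wt[of "slide x" n a r] slide_wt[of x n p "a + r - p" a r] K[OF that]
    by (simp add: C_def D_def P_def \<Phi>_def del: word_crystal.simps)
  have "crystal_morphism n C D (\<lambda>x. if x \<in> K then Some (\<Phi> x) else None)"
  proof (rule crystal_morphism_extend_by_None)
    show "y \<in> K" if "x \<in> K" "i \<in> {1..<n}" "eop C i x = Some y \<or> fop C i x = Some y" for x y i
      using that component_step unfolding K_def by fast
    show "x \<in> K" if "x \<in> elts C" "y \<in> K" "i \<in> {1..<n}" "eop C i x = Some y \<or> fop C i x = Some y" for x y i
    proof -
      have "fop C i y = Some x \<or> eop C i y = Some x"
        using that pair_inverse unfolding C_def by blast
      then show ?thesis using that component_step unfolding K_def by fast
    qed
    show "\<Phi> x \<in> elts D" if "x \<in> K" for x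
      using K[OF that] unfolding D_def P_def \<Phi>_def trim_elts by blast
  qed (use sub e f w in auto)
  moreover have "\<Phi> ` K = component n D h"
    unfolding K_def \<Phi>x0[symmetric] by (rule component_image) (use e f in \<open>auto simp: K_def\<close>)
  then have "(\<lambda>x. if x \<in> K then Some (\<Phi> x) else None) ` K = Some ` component n D h"
    by (simp add: image_image flip: \<open>\<Phi> ` K = component n D h\<close>)
  ultimately have ex: "is_atom_map n (a + r - p) (two_block a p r) (\<lambda>x. if x \<in> K then Some (\<Phi> x) else None)"
    unfolding atom_iff by simp
  have x0K: "x0 \<in> K" unfolding K_def by (rule component_self)
  \<comment> \<open>The value is nonzero because \<open>K\<close> is mapped into \<open>Some\<close>
    of the top component. It is a highest weight element of the weight of \<open>h\<close>, hence
    equal to \<open>h\<close>.\<close>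
  have val: "\<psi> x0 = Some h" if "is_atom_map n (a + r - p) (two_block a p r) \<psi>" for \<psi>
  proof -
    from that have m: "crystal_morphism n C D \<psi>" and "\<psi> x0 \<in> Some ` component n D h"
      using x0K unfolding atom_iff by blast+
    then obtain y where y: "\<psi> x0 = Some y" by blast
    \<comment> \<open>That the generator is of highest weight is pulled back along
      \<open>slide\<close>, which reflects zero.\<close>
    have ex0: "eop C i x0 = None" if "i \<in> {1..<n}" for i
    proof -
      have "eop P i (slide x0) = None"
        using pair_initial(1)[of a n r] assms that
        by (simp add: sx0 P_def highest_weight_element_def del: word_crystal.simps)
      then show ?thesis
        using slide_ops(1)[OF that, of x0 p "a + r - p" a r] x0 by (simp add: C_def P_def)
    qed
    have "highest_weight_element n D y"
      using m y x0 ex0 unfolding crystal_morphism_def highest_weight_element_def by fastforce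
    moreover have "wt D y = wt D h"
      using m y x0 w[OF x0K] unfolding crystal_morphism_def \<Phi>x0 by auto
    moreover have "wt D h = (\<lambda>j. \<Sum>k\<leftarrow>trim n a r a r. fund_weight k j)"
      using trim_highest[of a r n h] assms by (simp add: h_def D_def)
    ultimately have "y = h"
      using trim_highest[of a r n y] assms by (simp add: h_def D_def)
    with y show ?thesis by simp
  qed
  show ?thesis
  proof (rule ex1I[of _ "\<lambda>x. if x \<in> K then Some (\<Phi> x) else None"])
    show "is_atom_map n (a + r - p) (two_block a p r) (\<lambda>x. if x \<in> K then Some (\<Phi> x) else None)"
      by (rule ex)
    fix \<psi> assume \<psi>: "is_atom_map n (a + r - p) (two_block a p r) \<psi>"
    show "\<psi> = (\<lambda>x. if x \<in> K then Some (\<Phi> x) else None)"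
      by (rule crystal_morphism_eqI[of n C D _ _ x0])
        (use \<psi> ex val sub x0K \<Phi>x0 in \<open>auto simp: atom_iff K_def[symmetric]\<close>)
  qed
qed

section \<open>Counting\<close>

definition triples :: "nat \<Rightarrow> (nat \<times> nat \<times> nat) set" where
  "triples n = (SIGMA r:{..n}. SIGMA p:{..<r}. {..<p})"

text \<open>The truncated bound \<open>2 * p - r \<le> a\<close> says that \<open>p \<le> k\<close> for the second label \<open>k = a + r - p\<close>.\<close>

definition increasing_triples :: "nat \<Rightarrow> (nat \<times> nat \<times> nat) set" where
  "increasing_triples n = (SIGMA r:{..n}. SIGMA p:{..<r}. {2 * p - r..<p})"

definition triple_atom :: "nat \<Rightarrow> nat \<times> nat \<times> nat \<Rightarrow> atom" where
  "triple_atom n = (\<lambda>(r, p, a). ([p, a + r - p], trim n a r a r,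
    THE \<psi>. is_atom_map n (a + r - p) (two_block a p r) \<psi>))"

text \<open>The domain gives \<open>p\<close> and \<open>a + r\<close>, the codomain
  \<open>a\<close> and \<open>r\<close> up to trimming. A single label \<open>x\<close> could stem
  from \<open>a = x\<close>, \<open>r = n\<close> or from \<open>a = 0\<close>,
  \<open>r = x\<close>; the sum \<open>a + r\<close> decides.\<close>

lemma inj_on_triple_atom: "inj_on (triple_atom n) (triples n)"
  by (auto simp: inj_on_def triples_def triple_atom_def trim_def split: if_splits)

text \<open>The predicate \<open>Q\<close> serves both counts: it is constantly true for the first
  and \<open>\<le>\<close> for the second.\<close>

lemma atoms_two_strand:
  "{t \<in> atoms n. \<exists>i j. fst t = [i, j] \<and> Q i j} =
    triple_atom n ` {(r, p, a). (r, p, a) \<in> triples n \<and> Q p (a + r - p)}"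
proof (intro equalityI subsetI)
  fix t assume "t \<in> {t \<in> atoms n. \<exists>i j. fst t = [i, j] \<and> Q i j}"
  then obtain k b \<psi> i j where t: "t = (epsilon_word n k b @ [k], delta_word n k b, \<psi>)"
    and b: "b \<in> elts (fund_crystal n k)" and \<psi>: "is_atom_map n k b \<psi>"
    and fst: "fst t = [i, j]" and Q: "Q i j"
    unfolding atoms_def by blast
  from t fst have ij: "epsilon_word n k b = [i]" "k = j" by auto
  then obtain a r where ar: "a < i" "i < r" "r \<le> n" and b_eq: "b = two_block a i r" "k = a + r - i"
    using epsilon_word_singleton[OF b] by blast
  have "\<psi> = (THE \<psi>. is_atom_map n (a + r - i) (two_block a i r) \<psi>)"
    using the1_equality[OF two_block_atom[OF ar]] \<psi> b_eq by metis
  then have "t = triple_atom n (r, i, a)"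
    using t ij b_eq two_block_words(2)[OF ar] by (simp add: triple_atom_def)
  moreover have "(r, i, a) \<in> triples n" using ar by (simp add: triples_def)
  ultimately show "t \<in> triple_atom n ` {(r, p, a). (r, p, a) \<in> triples n \<and> Q p (a + r - p)}"
    using Q ij b_eq by blast
next
  fix t assume "t \<in> triple_atom n ` {(r, p, a). (r, p, a) \<in> triples n \<and> Q p (a + r - p)}"
  then obtain r p a where ar: "a < p" "p < r" "r \<le> n" and t: "t = triple_atom n (r, p, a)"
    and Q: "Q p (a + r - p)"
    by (auto simp: triples_def)
  define \<psi> where "\<psi> = (THE \<psi>. is_atom_map n (a + r - p) (two_block a p r) \<psi>)"
  have "is_atom_map n (a + r - p) (two_block a p r) \<psi>"
    unfolding \<psi>_def by (rule theI'[OF two_block_atom[OF ar]])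
  moreover have t_eq: "t = (epsilon_word n (a + r - p) (two_block a p r) @ [a + r - p],
      delta_word n (a + r - p) (two_block a p r), \<psi>)"
    by (simp add: t triple_atom_def two_block_words[OF ar] \<psi>_def)
  moreover have "a + r - p \<in> {1..<n}" using ar by auto
  ultimately have "t \<in> atoms n"
    unfolding atoms_def using two_block_fund_elts[OF ar] by blast
  then show "t \<in> {t \<in> atoms n. \<exists>i j. fst t = [i, j] \<and> Q i j}"
    using Q by (simp add: t triple_atom_def)
qed

lemma two_strand_atoms_eq: "two_strand_atoms n = triple_atom n ` triples n"
  using atoms_two_strand[of n "\<lambda>_ _. True"] by (simp add: two_strand_atoms_def)

lemma increasing_two_strand_atoms_eq:
  "increasing_two_strand_atoms n = triple_atom n ` increasing_triples n"
proof -
  have "increasing_triples n = {(r, p, a). (r, p, a) \<in> triples n \<and> p \<le> a + r - p}"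
    by (auto simp: increasing_triples_def triples_def)
  then show ?thesis
    using atoms_two_strand[of n "(\<le>)"] by (simp add: increasing_two_strand_atoms_def)
qed

lemma card_triples: "card (triples n) = (n + 1) choose 3"
proof -
  have "(\<Sum>p<r. p) = r choose 2" for r :: nat
    by (induction r) (auto simp: numeral_2_eq_2)
  then have "card (triples n) = (\<Sum>r\<le>n. r choose 2)" by (simp add: triples_def)
  also have "\<dots> = (n + 1) choose 3"
    \<comment> \<open>The hockey-stick identity.\<close>
    using sum_choose_upper[of 2 n] by (simp add: numeral_eq_Suc)
  finally show ?thesis .
qed

text \<open>The summand is \<open>min p (r - p)\<close>. Passing from \<open>r\<close> to
  \<open>r + 2\<close> and shifting \<open>p\<close> by one raises each term by one, which suggests
  induction in steps of two.\<close>

lemma sum_min_eq: "(\<Sum>p<r. p - (2 * p - r)) = r\<^sup>2 div (4::nat)"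
proof (induction r rule: nat_induct2)
  case 0
  show ?case by simp
next
  case 1
  show ?case by simp
next
  case (step r)
  have "(\<Sum>p<r + 2. p - (2 * p - (r + 2))) = (\<Sum>p<Suc r. Suc p - (2 * p - r))"
    by (simp add: sum.lessThan_Suc_shift del: sum.lessThan_Suc)
  also have "\<dots> = (\<Sum>p<Suc r. 1 + (p - (2 * p - r)))"
    by (intro sum.cong) auto
  also have "\<dots> = (\<Sum>p<Suc r. 1) + (\<Sum>p<Suc r. p - (2 * p - r))"
    by (rule sum.distrib)
  \<comment> \<open>The additional term at \<open>p = r\<close> vanishes.\<close>
  also have "\<dots> = Suc r + r\<^sup>2 div 4"
    using step.IH by simp
  also have "\<dots> = (r + 2)\<^sup>2 div 4"
    by (simp add: power2_eq_square algebra_simps)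
  finally show ?case .
qed

lemma card_increasing_triples: "card (increasing_triples n) = (\<Sum>r\<le>n. r\<^sup>2 div 4)"
  by (simp add: increasing_triples_def sum_min_eq)

lemma four_times_square_div_4: "4 * int (r\<^sup>2 div 4) = (int r)\<^sup>2 - of_bool (odd r)"
proof (cases "even r")
  case True
  then obtain m where "r = 2 * m" by (elim evenE)
  then show ?thesis by (simp add: power_mult_distrib)
next
  case False
  then obtain m where "r = 2 * m + 1" by (elim oddE)
  then have "r\<^sup>2 = 1 + 4 * (m * m + m)" by (simp add: power2_eq_square algebra_simps)
  then have "r\<^sup>2 div 4 = m * m + m" by simp
  then show ?thesis using \<open>r = 2 * m + 1\<close> by (simp add: power2_eq_square algebra_simps)
qed

text \<open>The parity term collects the rounding losses of the quarter squares. Clearing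
  denominators over the integers avoids both division and truncated subtraction.\<close>

lemma sum_quarter_squares:
  "24 * int (\<Sum>r\<le>n. r\<^sup>2 div 4) = int n * (2 * (int n)\<^sup>2 + 3 * int n - 2) - 3 * of_bool (odd n)"
proof (induction n)
  case 0
  show ?case by simp
next
  case (Suc n)
  have "24 * int (\<Sum>r\<le>Suc n. r\<^sup>2 div 4) =
      24 * int (\<Sum>r\<le>n. r\<^sup>2 div 4) + 6 * (4 * int ((Suc n)\<^sup>2 div 4))"
    by (simp add: algebra_simps)
  also have "\<dots> = int (Suc n) * (2 * (int (Suc n))\<^sup>2 + 3 * int (Suc n) - 2) - 3 * of_bool (odd (Suc n))"
    unfolding Suc.IH four_times_square_div_4
    by (cases "even n") (simp_all add: power2_eq_square algebra_simps)
  finally show ?case .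
qed

lemma real_choose_2: "real ((n + 1) choose 2) = real n * (real n + 1) / 2"
  by (induction n) (auto simp: numeral_2_eq_2 field_simps)

lemma real_choose_3: "real ((n + 1) choose 3) = real n * ((real n)\<^sup>2 - 1) / 6"
proof (induction n)
  case 0
  show ?case by simp
next
  case (Suc n)
  have "(Suc n + 1) choose 3 = ((n + 1) choose 2) + ((n + 1) choose 3)"
    by (simp add: numeral_eq_Suc)
  then show ?case using Suc real_choose_2[of n]
    by (simp add: power2_eq_square field_simps)
qed

theorem lemma2p5p4:
  fixes n :: nat
  assumes "n \<ge> 2"
  shows "card (two_strand_atoms n) = (n + 1) choose 3
    \<and> real ((n + 1) choose 3) = real n * ((real n)\<^sup>2 - 1) / 6
    \<and> int (card (increasing_two_strand_atoms n))
        = \<lfloor>real n * (2 * (real n)\<^sup>2 + 3 * real n - 2) / 24\<rfloor>"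
proof (intro conjI)
  show "card (two_strand_atoms n) = (n + 1) choose 3"
    by (simp add: two_strand_atoms_eq card_image[OF inj_on_triple_atom] card_triples)
  show "real ((n + 1) choose 3) = real n * ((real n)\<^sup>2 - 1) / 6"
    by (rule real_choose_3)
  have "increasing_triples n \<subseteq> triples n"
    by (auto simp: increasing_triples_def triples_def)
  then have "card (increasing_two_strand_atoms n) = (\<Sum>r\<le>n. r\<^sup>2 div 4)" (is "_ = ?s")
    using inj_on_subset[OF inj_on_triple_atom]
    by (simp add: increasing_two_strand_atoms_eq card_image card_increasing_triples)
  moreover have "real_of_int (24 * int ?s) =
      real_of_int (int n * (2 * (int n)\<^sup>2 + 3 * int n - 2) - 3 * of_bool (odd n))"
    by (simp only: sum_quarter_squares)
  then have "24 * real ?s = real n * (2 * (real n)\<^sup>2 + 3 * real n - 2) - 3 * of_bool (odd n)"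
    by simp
  \<comment> \<open>The quotient exceeds the sum by 0 or by 3/24, which is less than 1.\<close>
  then have "\<lfloor>real n * (2 * (real n)\<^sup>2 + 3 * real n - 2) / 24\<rfloor> = int ?s"
    by (intro floor_unique) (auto simp: of_bool_def split: if_splits)
  ultimately show "int (card (increasing_two_strand_atoms n))
        = \<lfloor>real n * (2 * (real n)\<^sup>2 + 3 * real n - 2) / 24\<rfloor>"
    by simp
qed

end
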